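(* Let $T_1,T_2:[1,\infty)\to(0,\infty)$ be non-decreasing and unbounded functions such that $\xi(T_1)<\xi(T_2)$, where $\xi$ stands for either the order or the lower order (the same choice on both sides of the inequality). Let $\phi:[1,\infty)\to(0,\infty)$ be any non-decreasing function such that $\log\phi(r)=o(\log r)$ as $r\to\infty$. Then the set $$P=\{r\ge1:\phi(r)T_1(r)<T_2(r)\}$$ satisfies $$\overline{\operatorname{logdens}}(P)\ge1-\frac{\xi(T_1)}{\xi(T_2)}\quad\text{and}\quad\overline{\operatorname{dens}}(P)=1 .$$
   Context: For a non-decreasing unbounded function $T:[1,\infty)\to(0,\infty)$, the order is $\limsup_{r\to\infty}\frac{\log T(r)}{\log r}\in[0,\infty]$ and the lower order is $\liminf_{r\to\infty}\frac{\log T(r)}{\log r}\in[0,\infty]$. If $\xi(T_2)=\infty$, the quotient $\xi(T_1)/\xi(T_2)$ is read as $0$. For a measurable set $D\subset[1,\infty)$, $$\overline{\operatorname{dens}}(D)=\limsup_{r\to\infty}\frac1r\int_{D\cap[1,r]}dt,\qquad \overline{\operatorname{logdens}}(D)=\limsup_{r\to\infty}\frac{1}{\log r}\int_{D\cap[1,r]}\frac{dt}{t}.$$ *)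

theory Defs
  imports "HOL-Analysis.Analysis" "HOL-Library.Landau_Symbols"
begin

text \<open>
  Functions on \<open>[1,\<infinity>)\<close> are represented by functions on all reals, of which only the values
  on \<open>{1..}\<close> matter. Orders and densities are extended reals; recall that \<open>x / \<infinity> = 0\<close>
  holds in type \<open>ereal\<close>.
\<close>

definition growth_order :: "(real \<Rightarrow> real) \<Rightarrow> ereal" where
  "growth_order T = Limsup at_top (\<lambda>r. ereal (ln (T r) / ln r))"

definition lower_growth_order :: "(real \<Rightarrow> real) \<Rightarrow> ereal" where
  "lower_growth_order T = Liminf at_top (\<lambda>r. ereal (ln (T r) / ln r))"

definition upper_dens :: "real set \<Rightarrow> ereal" where
  "upper_dens D = Limsup at_top (\<lambda>r. ereal (1 / r * (LINT t:D \<inter> {1..r}|lebesgue. 1)))"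

definition upper_logdens :: "real set \<Rightarrow> ereal" where
  "upper_logdens D = Limsup at_top (\<lambda>r. ereal (1 / ln r * (LINT t:D \<inter> {1..r}|lebesgue. 1 / t)))"

text \<open>The set whose densities are studied is measurable, so its densities are meaningful.\<close>

lemma comparison_set_measurable:
  fixes T1 T2 \<phi> :: "real \<Rightarrow> real"
  assumes "mono_on {1..} T1" "mono_on {1..} T2" "mono_on {1..} \<phi>"
  shows "{r. r \<ge> 1 \<and> \<phi> r * T1 r < T2 r} \<in> sets lebesgue"
proof -
  have m: "f \<in> borel_measurable (restrict_space borel {1..})"
    if "mono_on {1..} f" for f :: "real \<Rightarrow> real"
    using that by (rule borel_measurable_mono_on_fnc)
  note [measurable] = m[OF assms(1)] m[OF assms(2)] m[OF assms(3)]
  have "{r \<in> space (restrict_space borel {1..}). \<phi> r * T1 r < T2 r}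
      \<in> sets (restrict_space borel {1..})"
    by measurable
  moreover have "{r \<in> space (restrict_space borel {1..}). \<phi> r * T1 r < T2 r}
      = {r. r \<ge> 1 \<and> \<phi> r * T1 r < T2 r}"
    by (auto simp: space_restrict_space)
  ultimately have "{r. r \<ge> 1 \<and> \<phi> r * T1 r < T2 r} \<in> sets borel"
    by (simp add: sets_restrict_space_iff)
  then show ?thesis by (simp add: sets_completionI_sets)
qed

end

theory Submission
  imports Defs
begin

text \<open>
  Put \<open>f = \<phi> T1\<close> and \<open>g = T2\<close> and choose \<open>\<xi> T1 < \<alpha> < \<beta> < \<xi> T2\<close>. For the order, \<open>f r \<le> r powr \<alpha>\<close>
  eventually and \<open>g s > s powr \<beta>\<close> for arbitrarily large \<open>s\<close>; since \<open>g\<close> is monotone, \<open>f < g\<close> then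
  persists from \<open>s\<close> up to \<open>R = s powr (\<beta>/\<alpha>)\<close>. For the lower order, \<open>g r > r powr \<beta>\<close> eventually and
  \<open>f R \<le> R powr \<alpha>\<close> for arbitrarily large \<open>R\<close>; since \<open>f\<close> is monotone, \<open>f < g\<close> already holds from
  \<open>R powr (\<alpha>/\<beta>)\<close> up to \<open>R\<close>. In both cases the comparison set contains the intervals between
  \<open>R powr \<kappa>\<close> and \<open>R\<close>, \<open>\<kappa> = \<alpha>/\<beta>\<close>, for arbitrarily large \<open>R\<close>. These have logarithmic
  proportion \<open>1 - \<kappa>\<close> and linear proportion tending to \<open>1\<close>, and \<open>\<kappa>\<close> can be any number between
  \<open>\<xi> T1 / \<xi> T2\<close> and \<open>1\<close>.
\<close>

section \<open>Upper and lower limits in terms of frequent and eventual bounds\<close>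

lemma frequently_at_top_linorder:
  fixes P :: "'a::linorder \<Rightarrow> bool"
  shows "(\<exists>\<^sub>F x in at_top. P x) \<longleftrightarrow> (\<forall>N. \<exists>x\<ge>N. P x)"
  by (auto simp: frequently_def eventually_at_top_linorder)

lemma frequently_imp_le_Limsup:
  fixes f :: "'a \<Rightarrow> 'b::complete_linorder"
  assumes "\<exists>\<^sub>F x in F. c \<le> f x"
  shows "c \<le> Limsup F f"
proof (rule ccontr)
  assume "\<not> c \<le> Limsup F f"
  then have "\<forall>\<^sub>F x in F. f x < c"
    by (intro Limsup_lessD) simp
  with assms show False
    by (simp add: frequently_def not_le)
qed

lemma less_Limsup_imp_frequently:
  fixes f :: "'a \<Rightarrow> 'b::complete_linorder"
  assumes "c < Limsup F f"
  shows "\<exists>\<^sub>F x in F. c < f x"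
proof (rule ccontr)
  assume "\<not> (\<exists>\<^sub>F x in F. c < f x)"
  then have "Limsup F f \<le> c"
    by (intro Limsup_bounded) (simp add: frequently_def not_less)
  with assms show False by simp
qed

lemma Liminf_less_imp_frequently:
  fixes f :: "'a \<Rightarrow> 'b::complete_linorder"
  assumes "Liminf F f < c"
  shows "\<exists>\<^sub>F x in F. f x < c"
proof (rule ccontr)
  assume "\<not> (\<exists>\<^sub>F x in F. f x < c)"
  then have "c \<le> Liminf F f"
    by (intro Liminf_bounded) (simp add: frequently_def not_less)
  with assms show False by simp
qed

section \<open>Densities of sets that contain long intervals\<close>

text \<open>As \<open>w\<close> is nonnegative, enlarging the domain enlarges the integral; this
  compares the integrals in the densities with integrals over intervals, whose values are explicit.
  An open interval inside \<open>D\<close> suffices for the lower bound, since endpoints form a null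
  set.\<close>

lemma set_integral_between_interval_integrals:
  fixes w :: "real \<Rightarrow> real"
  assumes D: "D \<in> sets lebesgue" and w: "continuous_on {a..r} w" "\<And>t. t \<in> {a..r} \<Longrightarrow> 0 \<le> w t"
  shows "(LINT t:D \<inter> {a..r}|lebesgue. w t) \<le> integral {a..r} w"
    and "a \<le> x \<Longrightarrow> {x<..<r} \<subseteq> D \<Longrightarrow> integral {x..r} w \<le> (LINT t:D \<inter> {a..r}|lebesgue. w t)"
proof -
  have int: "set_integrable lebesgue {a..r} w"
    using w(1) by (rule absolutely_integrable_continuous_real)
  have intD: "set_integrable lebesgue (D \<inter> {a..r}) w"
    using D by (intro set_integrable_subset[OF int]) auto
  note D_eq = set_lebesgue_integral_eq_integral[OF intD]
  show "(LINT t:D \<inter> {a..r}|lebesgue. w t) \<le> integral {a..r} w"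
    unfolding D_eq(2) using w(2)
    by (intro integral_subset_le D_eq(1) set_lebesgue_integral_eq_integral(1)[OF int]) auto
  assume x: "a \<le> x" "{x<..<r} \<subseteq> D"
  have "set_integrable lebesgue {x<..<r} w"
    using x by (intro set_integrable_subset[OF int]) auto
  then show "integral {x..r} w \<le> (LINT t:D \<inter> {a..r}|lebesgue. w t)"
    unfolding D_eq(2) integral_open_interval_real using x w(2)
    by (intro integral_subset_le D_eq(1) set_lebesgue_integral_eq_integral(1)) auto
qed

lemma integral_inverse_eq_ln_diff:
  fixes x y :: real
  assumes "0 < x" "x \<le> y"
  shows "integral {x..y} (\<lambda>t. 1 / t) = ln y - ln x"
proof (rule integral_unique, rule fundamental_theorem_of_calculus[OF assms(2)])
  fix t assume "t \<in> {x..y}"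
  then have "(ln has_real_derivative 1 / t) (at t within {x..y})"
    using assms(1) by (auto intro!: derivative_eq_intros)
  then show "(ln has_vector_derivative 1 / t) (at t within {x..y})"
    by (simp add: has_real_derivative_iff_has_vector_derivative)
qed

text \<open>The interval from \<open>R powr \<kappa>\<close> to \<open>R\<close> has mass exactly
  \<open>(1 - \<kappa>) * ln R\<close> under \<open>dt / t\<close>, so the quotient is at least
  \<open>1 - \<kappa>\<close> at each such \<open>R > 1\<close>.\<close>

lemma upper_logdens_ge_of_powr_intervals:
  fixes \<kappa> :: real
  assumes D: "D \<in> sets lebesgue" and \<kappa>: "0 < \<kappa>" "\<kappa> < 1"
    and freq: "\<exists>\<^sub>F R in at_top. {R powr \<kappa><..<R} \<subseteq> D"
  shows "ereal (1 - \<kappa>) \<le> upper_logdens D"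
  unfolding upper_logdens_def
proof (rule frequently_imp_le_Limsup)
  have "\<exists>\<^sub>F R in at_top. {R powr \<kappa><..<R} \<subseteq> D \<and> R > 1"
    using freq eventually_gt_at_top by (rule frequently_eventually_frequently)
  then show "\<exists>\<^sub>F R in at_top. ereal (1 - \<kappa>) \<le> ereal (1 / ln R * (LINT t:D \<inter> {1..R}|lebesgue. 1 / t))"
  proof (rule frequently_elim1)
    fix R :: real assume R: "{R powr \<kappa><..<R} \<subseteq> D \<and> R > 1"
    have le: "1 \<le> R powr \<kappa>" "R powr \<kappa> \<le> R"
      using R \<kappa> powr_mono[of \<kappa> 1 R] by (auto intro: ge_one_powr_ge_zero)
    have "(1 - \<kappa>) * ln R = integral {R powr \<kappa>..R} (\<lambda>t. 1 / t)"
      using R le by (subst integral_inverse_eq_ln_diff) (auto simp: ln_powr algebra_simps)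
    also have "\<dots> \<le> (LINT t:D \<inter> {1..R}|lebesgue. 1 / t)"
      using R le by (intro set_integral_between_interval_integrals(2)[OF D])
        (auto intro!: continuous_intros)
    finally show "ereal (1 - \<kappa>) \<le> ereal (1 / ln R * (LINT t:D \<inter> {1..R}|lebesgue. 1 / t))"
      using R by (simp add: field_simps)
  qed
qed

lemma upper_dens_le_one:
  assumes D: "D \<in> sets lebesgue"
  shows "upper_dens D \<le> 1"
  unfolding upper_dens_def
proof (rule Limsup_bounded)
  show "\<forall>\<^sub>F R in at_top. ereal (1 / R * (LINT t:D \<inter> {1..R}|lebesgue. 1)) \<le> 1"
    using eventually_gt_at_top[of 1]
  proof eventually_elim
    fix R :: real assume R: "R > 1"
    have "(LINT t:D \<inter> {1..R}|lebesgue. 1) \<le> integral {1..R} (\<lambda>_. 1::real)"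
      by (intro set_integral_between_interval_integrals(1)[OF D]) auto
    also have "\<dots> \<le> R"
      using R by simp
    finally show "ereal (1 / R * (LINT t:D \<inter> {1..R}|lebesgue. 1)) \<le> 1"
      using R by (simp add: field_simps)
  qed
qed

text \<open>Up to \<open>R\<close>, the interval misses only the proportion
  \<open>R powr (\<kappa> - 1)\<close> of the length \<open>R\<close>, and this tends to
  \<open>0\<close> because \<open>\<kappa> < 1\<close>.\<close>

lemma upper_dens_eq_one_of_powr_intervals:
  fixes \<kappa> :: real
  assumes D: "D \<in> sets lebesgue" and \<kappa>: "0 < \<kappa>" "\<kappa> < 1"
    and freq: "\<exists>\<^sub>F R in at_top. {R powr \<kappa><..<R} \<subseteq> D"
  shows "upper_dens D = 1"
proof (rule antisym[OF upper_dens_le_one[OF D]])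
  have "ereal c \<le> upper_dens D" if c: "c < 1" for c
    unfolding upper_dens_def
  proof (rule frequently_imp_le_Limsup)
    have "((\<lambda>R::real. R powr (\<kappa> - 1)) \<longlongrightarrow> 0) at_top"
      using \<kappa> by (intro tendsto_neg_powr filterlim_ident) auto
    then have "\<forall>\<^sub>F R::real in at_top. R powr (\<kappa> - 1) < 1 - c"
      using c by (intro order_tendstoD(2)) auto
    then have "\<forall>\<^sub>F R::real in at_top. R powr (\<kappa> - 1) < 1 - c \<and> R > 1"
      using eventually_gt_at_top by (rule eventually_conj)
    with freq have "\<exists>\<^sub>F R in at_top. {R powr \<kappa><..<R} \<subseteq> D \<and> R powr (\<kappa> - 1) < 1 - c \<and> R > 1"
      by (rule frequently_eventually_frequently)
    then show "\<exists>\<^sub>F R in at_top. ereal c \<le> ereal (1 / R * (LINT t:D \<inter> {1..R}|lebesgue. 1))"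
    proof (rule frequently_elim1)
      fix R :: real assume R: "{R powr \<kappa><..<R} \<subseteq> D \<and> R powr (\<kappa> - 1) < 1 - c \<and> R > 1"
      have le: "1 \<le> R powr \<kappa>" "R powr \<kappa> \<le> R"
        using R \<kappa> powr_mono[of \<kappa> 1 R] by (auto intro: ge_one_powr_ge_zero)
      have "R powr \<kappa> = R powr (\<kappa> - 1) * R"
        using R by (simp add: powr_diff)
      also have "\<dots> \<le> (1 - c) * R"
        using R by (intro mult_right_mono) auto
      finally have "c * R \<le> R - R powr \<kappa>"
        by (simp add: algebra_simps)
      also have "\<dots> = integral {R powr \<kappa>..R} (\<lambda>_. 1::real)"
        using le by simp
      also have "\<dots> \<le> (LINT t:D \<inter> {1..R}|lebesgue. 1)"
        using R le by (intro set_integral_between_interval_integrals(2)[OF D]) auto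
      finally show "ereal c \<le> ereal (1 / R * (LINT t:D \<inter> {1..R}|lebesgue. 1))"
        using R by (simp add: field_simps)
    qed
  qed
  then have "y \<le> upper_dens D" if y: "y < 1" for y
  proof -
    obtain c where "y < ereal c" "ereal c < 1"
      using ereal_dense2[OF y] by auto
    with \<open>\<And>c. c < 1 \<Longrightarrow> ereal c \<le> upper_dens D\<close>[of c] show ?thesis
      by simp
  qed
  then show "1 \<le> upper_dens D"
    by (rule dense_le)
qed

section \<open>Power bounds that force \<open>f < g\<close> on long intervals\<close>

lemma powr_intervals_of_frequently_large:
  fixes f g :: "real \<Rightarrow> real"
  assumes \<alpha>: "0 < \<alpha>" "\<alpha> < \<beta>" and g: "mono_on {1..} g"
    and f_le: "\<forall>\<^sub>F r in at_top. f r \<le> r powr \<alpha>"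
    and g_gt: "\<exists>\<^sub>F r in at_top. r powr \<beta> < g r"
  shows "\<exists>\<^sub>F R in at_top. {R powr (\<alpha> / \<beta>)<..<R} \<subseteq> {r. r \<ge> 1 \<and> f r < g r}"
  unfolding frequently_at_top_linorder
proof
  fix N :: real
  obtain N1 where N1: "\<And>r. r \<ge> N1 \<Longrightarrow> f r \<le> r powr \<alpha>"
    using f_le by (auto simp: eventually_at_top_linorder)
  obtain s where s: "s \<ge> max 1 (max N N1)" "s powr \<beta> < g s"
    using g_gt unfolding frequently_at_top_linorder by blast
  \<comment> \<open>\<open>R\<close> solves \<open>R powr \<alpha> = s powr \<beta>\<close>: up to
    this point the bound on \<open>f\<close> stays below the value that \<open>g\<close> has already
    reached at \<open>s\<close>.\<close>
  define R where "R = s powr (\<beta> / \<alpha>)"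
  have "s \<le> R"
    using s \<alpha> powr_mono[of 1 "\<beta> / \<alpha>" s] by (simp add: R_def)
  have R_powr: "R powr (\<alpha> / \<beta>) = s" "R powr \<alpha> = s powr \<beta>"
    using s \<alpha> by (simp_all add: R_def powr_powr)
  have "f r < g r" if r: "s < r" "r < R" for r
  proof -
    have "f r \<le> r powr \<alpha>"
      using s r by (intro N1) auto
    also have "\<dots> \<le> R powr \<alpha>"
      using s r \<alpha> by (intro powr_mono2) auto
    also have "\<dots> < g s"
      using R_powr s by simp
    also have "\<dots> \<le> g r"
      using s r by (intro mono_onD[OF g]) auto
    finally show ?thesis .
  qed
  then have "{R powr (\<alpha> / \<beta>)<..<R} \<subseteq> {r. r \<ge> 1 \<and> f r < g r}"
    using s by (auto simp: R_powr)
  with \<open>s \<le> R\<close> s show "\<exists>R\<ge>N. {R powr (\<alpha> / \<beta>)<..<R} \<subseteq> {r. r \<ge> 1 \<and> f r < g r}"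
    by (intro exI[of _ R]) auto
qed

lemma powr_intervals_of_frequently_small:
  fixes f g :: "real \<Rightarrow> real"
  assumes \<alpha>: "0 < \<alpha>" "\<alpha> < \<beta>" and f: "mono_on {1..} f"
    and f_le: "\<exists>\<^sub>F r in at_top. f r \<le> r powr \<alpha>"
    and g_gt: "\<forall>\<^sub>F r in at_top. r powr \<beta> < g r"
  shows "\<exists>\<^sub>F R in at_top. {R powr (\<alpha> / \<beta>)<..<R} \<subseteq> {r. r \<ge> 1 \<and> f r < g r}"
  unfolding frequently_at_top_linorder
proof
  fix N :: real
  obtain N1 where N1: "\<And>r. r \<ge> N1 \<Longrightarrow> r powr \<beta> < g r"
    using g_gt by (auto simp: eventually_at_top_linorder)
  define M where "M = max 1 N1"
  have "M powr (\<beta> / \<alpha>) \<ge> 1"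
    using \<alpha> by (intro ge_one_powr_ge_zero) (auto simp: M_def)
  \<comment> \<open>The threshold \<open>M powr (\<beta> / \<alpha>)\<close> ensures that the left
    endpoint \<open>R powr (\<alpha> / \<beta>)\<close> is at least \<open>M\<close>, so the lower
    bound on \<open>g\<close> holds throughout the interval.\<close>
  obtain R where R: "R \<ge> max N (M powr (\<beta> / \<alpha>))" "f R \<le> R powr \<alpha>"
    using f_le unfolding frequently_at_top_linorder by blast
  define s where "s = R powr (\<alpha> / \<beta>)"
  have s_powr: "s powr \<beta> = R powr \<alpha>"
    using \<alpha> by (simp add: s_def powr_powr)
  have "M = (M powr (\<beta> / \<alpha>)) powr (\<alpha> / \<beta>)"
    using \<alpha> by (simp add: powr_powr M_def)
  also have "\<dots> \<le> s"
    unfolding s_def using R \<alpha> by (intro powr_mono2) auto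
  finally have s: "1 \<le> s" "N1 \<le> s"
    by (auto simp: M_def)
  have "f r < g r" if r: "s < r" "r < R" for r
  proof -
    have "f r \<le> f R"
      using s r by (intro mono_onD[OF f]) auto
    also have "\<dots> \<le> s powr \<beta>"
      using R s_powr by simp
    also have "\<dots> \<le> r powr \<beta>"
      using s r \<alpha> by (intro powr_mono2) auto
    also have "\<dots> < g r"
      using s r by (intro N1) auto
    finally show ?thesis .
  qed
  then have "{R powr (\<alpha> / \<beta>)<..<R} \<subseteq> {r. r \<ge> 1 \<and> f r < g r}"
    using s by (auto simp flip: s_def)
  with R show "\<exists>R\<ge>N. {R powr (\<alpha> / \<beta>)<..<R} \<subseteq> {r. r \<ge> 1 \<and> f r < g r}"
    by (intro exI[of _ R]) auto
qed

section \<open>From orders of growth to power bounds\<close>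

lemma ln_quotient_less_iff:
  fixes r y \<alpha> :: real
  assumes "1 < r" "0 < y"
  shows "ln y / ln r < \<alpha> \<longleftrightarrow> y < r powr \<alpha>" and "\<alpha> < ln y / ln r \<longleftrightarrow> r powr \<alpha> < y"
proof -
  have "ln (r powr \<alpha>) = \<alpha> * ln r" "0 < r powr \<alpha>" "0 < ln r"
    using assms by (auto simp: ln_powr)
  then show "ln y / ln r < \<alpha> \<longleftrightarrow> y < r powr \<alpha>" "\<alpha> < ln y / ln r \<longleftrightarrow> r powr \<alpha> < y"
    using assms ln_less_cancel_iff[of y "r powr \<alpha>"] ln_less_cancel_iff[of "r powr \<alpha>" y]
    by (auto simp: field_simps)
qed

text \<open>The factor \<open>\<phi>\<close> costs at most an arbitrarily small power of
  \<open>r\<close>, which a gap between exponents can absorb.\<close>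

lemma eventually_le_powr_of_ln_smallo:
  fixes \<phi> :: "real \<Rightarrow> real"
  assumes pos: "\<forall>r\<ge>1. 0 < \<phi> r" and small: "(\<lambda>r. ln (\<phi> r)) \<in> o[at_top](\<lambda>r. ln r)" and "0 < \<epsilon>"
  shows "\<forall>\<^sub>F r in at_top. \<phi> r \<le> r powr \<epsilon>"
  using landau_o.smallD[OF small \<open>0 < \<epsilon>\<close>] eventually_gt_at_top[of 1]
proof eventually_elim
  case (elim r)
  then have "ln (\<phi> r) \<le> \<epsilon> * ln r"
    by simp
  also have "\<dots> = ln (r powr \<epsilon>)"
    using elim by (simp add: ln_powr)
  finally show ?case
    using elim pos by (subst (asm) ln_le_cancel_iff) auto
qed

text \<open>Unboundedness gives a point where \<open>T\<close> exceeds \<open>1\<close>, and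
  monotonicity keeps it above \<open>1\<close> from there on, so \<open>ln (T r)\<close> is
  eventually positive.\<close>

lemma lower_growth_order_nonneg:
  fixes T :: "real \<Rightarrow> real"
  assumes "mono_on {1..} T" "\<not> bdd_above (T ` {1..})"
  shows "0 \<le> lower_growth_order T"
  unfolding lower_growth_order_def
proof (rule Liminf_bounded)
  obtain s where s: "s \<ge> 1" "T s > 1"
    using assms(2) by (force simp: bdd_above_def not_le)
  show "\<forall>\<^sub>F r in at_top. 0 \<le> ereal (ln (T r) / ln r)"
    using eventually_ge_at_top[of s]
  proof eventually_elim
    fix r assume r: "s \<le> r"
    have "T s \<le> T r"
      using s r by (intro mono_onD[OF assms(1)]) auto
    then show "0 \<le> ereal (ln (T r) / ln r)"
      using s r by simp
  qed
qed

lemma lower_growth_order_le_growth_order: "lower_growth_order T \<le> growth_order T"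
  unfolding lower_growth_order_def growth_order_def by (rule Liminf_le_Limsup) simp

text \<open>The order makes the upper bound on \<open>T1\<close> eventual and the lower bound on
  \<open>T2\<close> frequent; the lower order exchanges these roles. Each case matches one of the
  two interval lemmas.\<close>

lemma powr_intervals_subset_comparison_set:
  fixes T1 T2 \<phi> :: "real \<Rightarrow> real" and \<xi> :: "(real \<Rightarrow> real) \<Rightarrow> ereal"
  assumes T1: "\<forall>r\<ge>1. 0 < T1 r" "mono_on {1..} T1"
    and T2: "\<forall>r\<ge>1. 0 < T2 r" "mono_on {1..} T2"
    and \<phi>: "\<forall>r\<ge>1. 0 < \<phi> r" "mono_on {1..} \<phi>" "(\<lambda>r. ln (\<phi> r)) \<in> o[at_top](\<lambda>r. ln r)"
    and xi: "\<xi> = growth_order \<or> \<xi> = lower_growth_order"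
    and \<alpha>: "0 < \<alpha>" "\<alpha> < \<beta>" "\<xi> T1 < ereal \<alpha>" "ereal \<beta> < \<xi> T2"
  shows "\<exists>\<^sub>F R in at_top. {R powr (\<alpha> / \<beta>)<..<R} \<subseteq> {r. r \<ge> 1 \<and> \<phi> r * T1 r < T2 r}"
proof -
  \<comment> \<open>With \<open>r powr \<gamma>\<close> bounding \<open>T1\<close>, a factor
    \<open>r powr (\<alpha> - \<gamma>)\<close> is left over for \<open>\<phi>\<close>.\<close>
  obtain \<gamma> where \<gamma>: "\<xi> T1 < ereal \<gamma>" "\<gamma> < \<alpha>"
    using ereal_dense2[OF \<alpha>(3)] by auto
  have "\<forall>\<^sub>F r in at_top. \<phi> r \<le> r powr (\<alpha> - \<gamma>)"
    using \<phi> \<gamma> by (intro eventually_le_powr_of_ln_smallo) auto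
  \<comment> \<open>The implication form serves both cases, whether its premise holds eventually or
    only frequently.\<close>
  then have T1_step: "\<forall>\<^sub>F r in at_top. ereal (ln (T1 r) / ln r) < ereal \<gamma> \<longrightarrow> \<phi> r * T1 r \<le> r powr \<alpha>"
    using eventually_gt_at_top[of 1]
  proof eventually_elim
    fix r :: real assume r: "\<phi> r \<le> r powr (\<alpha> - \<gamma>)" "1 < r"
    show "ereal (ln (T1 r) / ln r) < ereal \<gamma> \<longrightarrow> \<phi> r * T1 r \<le> r powr \<alpha>"
    proof
      assume "ereal (ln (T1 r) / ln r) < ereal \<gamma>"
      then have "T1 r < r powr \<gamma>"
        using r T1 by (simp add: ln_quotient_less_iff)
      then have "\<phi> r * T1 r \<le> r powr (\<alpha> - \<gamma>) * r powr \<gamma>"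
        using r T1(1) by (intro mult_mono) (auto simp: less_imp_le)
      then show "\<phi> r * T1 r \<le> r powr \<alpha>"
        by (simp flip: powr_add)
    qed
  qed
  have T2_step: "\<forall>\<^sub>F r in at_top. ereal \<beta> < ereal (ln (T2 r) / ln r) \<longrightarrow> r powr \<beta> < T2 r"
    using eventually_gt_at_top[of 1]
    by eventually_elim (use T2 in \<open>simp add: ln_quotient_less_iff\<close>)
  from xi show ?thesis
  proof
    assume \<xi>: "\<xi> = growth_order"
    have "\<forall>\<^sub>F r in at_top. ereal (ln (T1 r) / ln r) < ereal \<gamma>"
      using \<gamma>(1) unfolding \<xi> growth_order_def by (rule Limsup_lessD)
    then have "\<forall>\<^sub>F r in at_top. \<phi> r * T1 r \<le> r powr \<alpha>"
      using T1_step by eventually_elim simp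
    moreover have "\<exists>\<^sub>F r in at_top. ereal \<beta> < ereal (ln (T2 r) / ln r)"
      using \<alpha>(4) unfolding \<xi> growth_order_def by (rule less_Limsup_imp_frequently)
    then have "\<exists>\<^sub>F r in at_top. r powr \<beta> < T2 r"
      by (rule frequently_rev_mp) (rule T2_step)
    ultimately show ?thesis
      using \<alpha> T2 by (intro powr_intervals_of_frequently_large)
  next
    assume \<xi>: "\<xi> = lower_growth_order"
    have "\<exists>\<^sub>F r in at_top. ereal (ln (T1 r) / ln r) < ereal \<gamma>"
      using \<gamma>(1) unfolding \<xi> lower_growth_order_def by (rule Liminf_less_imp_frequently)
    then have "\<exists>\<^sub>F r in at_top. \<phi> r * T1 r \<le> r powr \<alpha>"
      by (rule frequently_rev_mp) (rule T1_step)
    moreover have "\<forall>\<^sub>F r in at_top. ereal \<beta> < ereal (ln (T2 r) / ln r)"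
      using \<alpha>(4) unfolding \<xi> lower_growth_order_def by (rule less_LiminfD)
    then have "\<forall>\<^sub>F r in at_top. r powr \<beta> < T2 r"
      using T2_step by eventually_elim simp
    moreover have "mono_on {1..} (\<lambda>r. \<phi> r * T1 r)"
      using T1 \<phi> by (intro mono_onI mult_mono) (auto simp: less_imp_le intro: mono_onD)
    ultimately show ?thesis
      using \<alpha> by (intro powr_intervals_of_frequently_small)
  qed
qed

section \<open>Choice of the exponents and computation of both densities\<close>

theorem corollary4p5:
  fixes T1 T2 \<phi> :: "real \<Rightarrow> real" and \<xi> :: "(real \<Rightarrow> real) \<Rightarrow> ereal"
  assumes T1_pos: "\<forall>r\<ge>1. 0 < T1 r"
    and T1_mono: "mono_on {1..} T1"
    and T1_unbdd: "\<not> bdd_above (T1 ` {1..})"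
    and T2_pos: "\<forall>r\<ge>1. 0 < T2 r"
    and T2_mono: "mono_on {1..} T2"
    and T2_unbdd: "\<not> bdd_above (T2 ` {1..})"
    and xi: "\<xi> = growth_order \<or> \<xi> = lower_growth_order"
    and xi_less: "\<xi> T1 < \<xi> T2"
    and phi_pos: "\<forall>r\<ge>1. 0 < \<phi> r"
    and phi_mono: "mono_on {1..} \<phi>"
    and phi_small: "(\<lambda>r. ln (\<phi> r)) \<in> o[at_top](\<lambda>r. ln r)"
  shows "upper_logdens {r. r \<ge> 1 \<and> \<phi> r * T1 r < T2 r} \<ge> 1 - \<xi> T1 / \<xi> T2
       \<and> upper_dens {r. r \<ge> 1 \<and> \<phi> r * T1 r < T2 r} = 1"
proof -
  define P where "P = {r. r \<ge> 1 \<and> \<phi> r * T1 r < T2 r}"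
  have P: "P \<in> sets lebesgue"
    unfolding P_def by (rule comparison_set_measurable[OF T1_mono T2_mono phi_mono])
  have "0 \<le> \<xi> T1"
    using xi lower_growth_order_nonneg[OF T1_mono T1_unbdd] lower_growth_order_le_growth_order[of T1]
    by auto
  \<comment> \<open>Being nonnegative and strictly below \<open>\<xi> T2\<close>, the value
    \<open>\<xi> T1\<close> is finite; only \<open>\<xi> T2\<close> may be infinite.\<close>
  with xi_less obtain a where a: "\<xi> T1 = ereal a" "0 \<le> a"
    by (cases "\<xi> T1") auto
  have intervals: "\<exists>\<^sub>F R in at_top. {R powr \<kappa><..<R} \<subseteq> P"
    if \<kappa>: "0 < \<kappa>" "\<kappa> < 1" "ereal (a / \<kappa>) < \<xi> T2" for \<kappa>
  proof -
    obtain \<beta> where \<beta>: "a / \<kappa> < \<beta>" "ereal \<beta> < \<xi> T2"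
      using ereal_dense2[OF \<kappa>(3)] by auto
    have "0 < \<beta>"
      using \<beta>(1) a(2) \<kappa>(1) by (smt (verit) divide_nonneg_pos)
    \<comment> \<open>Here \<open>\<alpha> = \<kappa> * \<beta>\<close>, so that
      \<open>a / \<kappa> < \<beta>\<close> says \<open>\<xi> T1 < \<alpha>\<close>; since
      \<open>\<beta> > 0\<close>, this \<open>\<alpha>\<close> is positive even if
      \<open>a = 0\<close>.\<close>
    have "\<exists>\<^sub>F R in at_top. {R powr (\<kappa> * \<beta> / \<beta>)<..<R} \<subseteq> P"
      unfolding P_def using \<beta> \<kappa> a \<open>0 < \<beta>\<close>
      by (intro powr_intervals_subset_comparison_set[OF T1_pos T1_mono T2_pos T2_mono
            phi_pos phi_mono phi_small xi]) (auto simp: field_simps)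
    then show ?thesis
      using \<open>0 < \<beta>\<close> by simp
  qed
  \<comment> \<open>The quotient is a real number in every case: \<open>a / b\<close> if
    \<open>\<xi> T2\<close> is a finite \<open>b\<close>, and \<open>0\<close> if
    \<open>\<xi> T2\<close> is infinite.\<close>
  obtain q where q: "\<xi> T1 / \<xi> T2 = ereal q" "0 \<le> q" "q < 1"
    and q_less: "\<And>\<kappa>. 0 < \<kappa> \<Longrightarrow> q < \<kappa> \<Longrightarrow> ereal (a / \<kappa>) < \<xi> T2"
  proof (cases "\<xi> T2")
    case (real b)
    with xi_less a show ?thesis
      by (intro that[of "a / b"]) (auto simp: field_simps)
  next
    case PInf
    with a show ?thesis
      by (intro that[of 0]) auto
  next
    case MInf
    with xi_less show ?thesis by simp
  qed
  have "ereal (1 - q) \<le> upper_logdens P"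
  proof (rule dense_le)
    fix y assume y: "y < ereal (1 - q)"
    obtain c where c: "y < ereal c" "c < 1 - q"
      using ereal_dense2[OF y] by auto
    \<comment> \<open>The first entry gives \<open>c \<le> 1 - \<kappa>\<close>; the second, the
      midpoint of \<open>q\<close> and \<open>1\<close>, keeps \<open>\<kappa> < 1\<close> when
      \<open>c \<le> 0\<close>. Both exceed \<open>q\<close>.\<close>
    define \<kappa> where "\<kappa> = min (1 - c) ((1 + q) / 2)"
    have \<kappa>: "q < \<kappa>" "\<kappa> < 1" "c \<le> 1 - \<kappa>"
      using c q by (auto simp: \<kappa>_def min_def field_simps)
    have "ereal (1 - \<kappa>) \<le> upper_logdens P"
      using \<kappa> q by (intro upper_logdens_ge_of_powr_intervals[OF P] intervals q_less) auto
    moreover have "y \<le> ereal (1 - \<kappa>)"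
      using c(1) \<kappa>(3) by (meson ereal_less_eq(3) less_imp_le order_trans)
    ultimately show "y \<le> upper_logdens P"
      by (rule order_trans[rotated])
  qed
  moreover have "1 - \<xi> T1 / \<xi> T2 = ereal (1 - q)"
    by (simp add: q one_ereal_def)
  \<comment> \<open>For the linear density a single exponent strictly between \<open>q\<close> and
    \<open>1\<close> is enough.\<close>
  moreover obtain \<kappa> where "q < \<kappa>" "\<kappa> < 1"
    using dense[OF q(3)] by auto
  then have "upper_dens P = 1"
    using q by (intro upper_dens_eq_one_of_powr_intervals[OF P, of \<kappa>] intervals q_less) auto
  ultimately show ?thesis
    by (simp add: P_def)
qed

end
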